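(* If there exists $\lambda_0\in\Omega'(\mathcal{M},d)$ such that $(E_{\lambda_0})$ has two linearly independent solutions in $l^2(\mathcal{I})$, then $\mathcal{L}$ is in the limit circle case (LCC) at $t=\infty$. Otherwise (i.e. if no such $\lambda_0$ exists), $\mathcal{L}$ is in the limit point case (LPC) at $t=\infty$.
   Context: Let $a\in\mathbb{Z}$, $\mathcal{I}=\{a,a+1,\dots\}$, $\mathcal{I}'=\{a-1,a,a+1,\dots\}$, $\mathcal{I}_N=\{a,\dots,N\}$. $\nabla y(t)=y(t)-y(t-1)$, $\Delta y(t)=y(t+1)-y(t)$. Let $p,q,c,h,d:\mathcal{I}'\to\mathbb{R}$ with $p(t)\ne0$ for all $t$. For $\lambda\in\mathbb{C}$, $(E_\lambda)$ (abbreviated $\mathcal{L}(y)=\lambda y$) is the system for $y=(y_1,y_2)^{\mathrm T}:\mathcal{I}'\to\mathbb{C}^2$: $$-\nabla(p(t)\Delta y_1(t))+q(t)y_1(t)-\nabla(c(t)y_2(t))+h(t)y_2(t)=\lambda y_1(t),\quad t\in\mathcal{I},$$ $$c(t)\Delta y_1(t)+h(t)y_1(t)+d(t)y_2(t)=\lambda y_2(t),\quad t\in\mathcal{I}'.$$ $y^{[1]}(t)=p(t)\Delta y_1(t)+c(t)y_2(t)$, $t\in\mathcal{I}'$. $l^2(\mathcal{I})$ is the set of $y:\mathcal{I}'\to\mathbb{C}^2$ with $\sum_{t\in\mathcal{I}}y^*(t)y(t)<\infty$ ($^*$ = conjugate transpose). For a real function $f$ on $\mathcal{I}'$, $\sigma(f)=\{\lambda\in\mathbb{R}:\inf_{t\in\mathcal{I}'}|\lambda-f(t)|=0\}$;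 $\mathcal{M}(t)=d(t)-\frac{c^2(t)-h(t)c(t)}{p(t)}$, $\Omega'(\mathcal{M},d)=\mathbb{C}\setminus(\sigma(\mathcal{M})\cup\sigma(d))$ (which contains $\mathbb{C}\setminus\mathbb{R}$). Weyl circles and LCC/LPC. For $\lambda\in\mathbb{C}\setminus\mathbb{R}$ and $\alpha\in[0,\pi)$ let $\varphi,\psi$ be the solutions of $(E_\lambda)$ with $\varphi_1(a)=\sin\alpha$, $\varphi^{[1]}(a-1)=-\cos\alpha$, $\psi_1(a)=\cos\alpha$, $\psi^{[1]}(a-1)=\sin\alpha$. For an integer $N>a$ and $\beta\in[0,\pi)$ put $U_2(y)=y_1(N+1)\cos\beta+y^{[1]}(N)\sin\beta$. As $\beta$ ranges over $[0,\pi)$, the points $m=-U_2(\varphi)/U_2(\psi)$ describe a circle $C_N$ in $\mathbb{C}$; the closed discs bounded by $C_N$ decrease as $N$ increases. The sequence $\{C_N\}$ is said to converge to a point if the intersection of these closed discs is a single point, and to converge to a circle if this intersection is a closed disc of positive radius. $\mathcal{L}$ is in the LCC (resp. LPC) at $t=\infty$ if $\{C_N\}$ converges to a circle (resp. to a point), for every $\lambda\in\mathbb{C}\setminus\mathbb{R}$ and every $\alpha\in[0,\pi)$. *)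

theory Defs
  imports "HOL-Analysis.Analysis"
begin

text \<open>
  The index set \<open>\<I> = {a, a+1, \<dots>}\<close> is \<open>{a..}\<close> and \<open>\<I>' = {a-1, a, \<dots>}\<close> is \<open>{a - 1..}\<close> in \<open>int\<close>.
  Functions on \<open>\<I>'\<close> are represented by total functions on \<open>int\<close>; no definition below depends on
  their values outside \<open>\<I>'\<close>.
\<close>

definition nabla :: "(int \<Rightarrow> 'a::ab_group_add) \<Rightarrow> int \<Rightarrow> 'a" where
  "nabla y t = y t - y (t - 1)"

definition delta :: "(int \<Rightarrow> 'a::ab_group_add) \<Rightarrow> int \<Rightarrow> 'a" where
  "delta y t = y (t + 1) - y t"

definition solution ::
  "int \<Rightarrow> (int \<Rightarrow> real) \<Rightarrow> (int \<Rightarrow> real) \<Rightarrow> (int \<Rightarrow> real) \<Rightarrow> (int \<Rightarrow> real) \<Rightarrow> (int \<Rightarrow> real) \<Rightarrow>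
    complex \<Rightarrow> (int \<Rightarrow> complex ^ 2) \<Rightarrow> bool" where
  "solution a p q c h d lam y \<longleftrightarrow>
    (\<forall>t\<in>{a..}.
       - nabla (\<lambda>s. of_real (p s) * delta (\<lambda>u. y u $ 1) s) t + of_real (q t) * y t $ 1
       - nabla (\<lambda>s. of_real (c s) * y s $ 2) t + of_real (h t) * y t $ 2 = lam * y t $ 1) \<and>
    (\<forall>t\<in>{a - 1..}.
       of_real (c t) * delta (\<lambda>u. y u $ 1) t + of_real (h t) * y t $ 1 + of_real (d t) * y t $ 2
         = lam * y t $ 2)"

definition quasi_deriv ::
  "(int \<Rightarrow> real) \<Rightarrow> (int \<Rightarrow> real) \<Rightarrow> (int \<Rightarrow> complex ^ 2) \<Rightarrow> int \<Rightarrow> complex" where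
  "quasi_deriv p c y t = of_real (p t) * delta (\<lambda>u. y u $ 1) t + of_real (c t) * y t $ 2"

text \<open>The norm on \<open>complex ^ 2\<close> is Euclidean, so \<open>(norm (y t))\<^sup>2\<close> is \<open>y\<^sup>*(t) y(t)\<close>.\<close>

definition l2 :: "int \<Rightarrow> (int \<Rightarrow> complex ^ 2) set" where
  "l2 a = {y. (\<lambda>t. (norm (y t))\<^sup>2) summable_on {a..}}"

text \<open>Linear independence over the complex numbers as functions on \<open>\<I>'\<close>.\<close>

definition lin_indep :: "int \<Rightarrow> (int \<Rightarrow> complex ^ 2) \<Rightarrow> (int \<Rightarrow> complex ^ 2) \<Rightarrow> bool" where
  "lin_indep a y z \<longleftrightarrow>
    (\<forall>\<kappa> \<mu>. (\<forall>t\<in>{a - 1..}. \<kappa> *s y t + \<mu> *s z t = 0) \<longrightarrow> \<kappa> = 0 \<and> \<mu> = 0)"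

definition sigma_range :: "int \<Rightarrow> (int \<Rightarrow> real) \<Rightarrow> real set" where
  "sigma_range a f = {lam. (INF t\<in>{a - 1..}. \<bar>lam - f t\<bar>) = 0}"

definition M_fun ::
  "(int \<Rightarrow> real) \<Rightarrow> (int \<Rightarrow> real) \<Rightarrow> (int \<Rightarrow> real) \<Rightarrow> (int \<Rightarrow> real) \<Rightarrow> int \<Rightarrow> real" where
  "M_fun p c h d t = d t - ((c t)\<^sup>2 - h t * c t) / p t"

definition Omega' :: "int \<Rightarrow> (int \<Rightarrow> real) \<Rightarrow> (int \<Rightarrow> real) \<Rightarrow> complex set" where
  "Omega' a M d = UNIV - complex_of_real ` (sigma_range a M \<union> sigma_range a d)"

text \<open>
  A solution with prescribed data at the left end point exists and is unique on
  \<open>\<I>'\<close> for nonreal \<open>lam\<close>;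
  the choice operator only fixes the irrelevant values outside \<open>\<I>'\<close>.
\<close>

definition ivp_solution ::
  "int \<Rightarrow> (int \<Rightarrow> real) \<Rightarrow> (int \<Rightarrow> real) \<Rightarrow> (int \<Rightarrow> real) \<Rightarrow> (int \<Rightarrow> real) \<Rightarrow> (int \<Rightarrow> real) \<Rightarrow>
    complex \<Rightarrow> complex \<Rightarrow> complex \<Rightarrow> int \<Rightarrow> complex ^ 2" where
  "ivp_solution a p q c h d lam u v =
    (SOME y. solution a p q c h d lam y \<and> y a $ 1 = u \<and> quasi_deriv p c y (a - 1) = v)"

definition weyl_phi ::
  "int \<Rightarrow> (int \<Rightarrow> real) \<Rightarrow> (int \<Rightarrow> real) \<Rightarrow> (int \<Rightarrow> real) \<Rightarrow> (int \<Rightarrow> real) \<Rightarrow> (int \<Rightarrow> real) \<Rightarrow>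
    complex \<Rightarrow> real \<Rightarrow> int \<Rightarrow> complex ^ 2" where
  "weyl_phi a p q c h d lam \<alpha> =
    ivp_solution a p q c h d lam (of_real (sin \<alpha>)) (of_real (- cos \<alpha>))"

definition weyl_psi ::
  "int \<Rightarrow> (int \<Rightarrow> real) \<Rightarrow> (int \<Rightarrow> real) \<Rightarrow> (int \<Rightarrow> real) \<Rightarrow> (int \<Rightarrow> real) \<Rightarrow> (int \<Rightarrow> real) \<Rightarrow>
    complex \<Rightarrow> real \<Rightarrow> int \<Rightarrow> complex ^ 2" where
  "weyl_psi a p q c h d lam \<alpha> =
    ivp_solution a p q c h d lam (of_real (cos \<alpha>)) (of_real (sin \<alpha>))"

definition U2 ::
  "(int \<Rightarrow> real) \<Rightarrow> (int \<Rightarrow> real) \<Rightarrow> int \<Rightarrow> real \<Rightarrow> (int \<Rightarrow> complex ^ 2) \<Rightarrow> complex" where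
  "U2 p c N \<beta> y = y (N + 1) $ 1 * of_real (cos \<beta>) + quasi_deriv p c y N * of_real (sin \<beta>)"

definition weyl_circle ::
  "int \<Rightarrow> (int \<Rightarrow> real) \<Rightarrow> (int \<Rightarrow> real) \<Rightarrow> (int \<Rightarrow> real) \<Rightarrow> (int \<Rightarrow> real) \<Rightarrow> (int \<Rightarrow> real) \<Rightarrow>
    complex \<Rightarrow> real \<Rightarrow> int \<Rightarrow> complex set" where
  "weyl_circle a p q c h d lam \<alpha> N =
    (\<lambda>\<beta>. - U2 p c N \<beta> (weyl_phi a p q c h d lam \<alpha>) / U2 p c N \<beta> (weyl_psi a p q c h d lam \<alpha>))
      ` {0..<pi}"

text \<open>
  A circle determines its centre and radius, so for a circle \<open>C\<close> this is the one closed disc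
  with boundary \<open>C\<close>; for any other set \<open>C\<close> it is empty.
\<close>

definition disc_of :: "complex set \<Rightarrow> complex set" where
  "disc_of C = {m. \<exists>z r. r > 0 \<and> C = sphere z r \<and> m \<in> cball z r}"

definition converges_to_point :: "int \<Rightarrow> (int \<Rightarrow> complex set) \<Rightarrow> bool" where
  "converges_to_point a C \<longleftrightarrow> (\<exists>z. (\<Inter>N\<in>{a<..}. disc_of (C N)) = {z})"

definition converges_to_circle :: "int \<Rightarrow> (int \<Rightarrow> complex set) \<Rightarrow> bool" where
  "converges_to_circle a C \<longleftrightarrow> (\<exists>z r. r > 0 \<and> (\<Inter>N\<in>{a<..}. disc_of (C N)) = cball z r)"

definition LCC ::
  "int \<Rightarrow> (int \<Rightarrow> real) \<Rightarrow> (int \<Rightarrow> real) \<Rightarrow> (int \<Rightarrow> real) \<Rightarrow> (int \<Rightarrow> real) \<Rightarrow> (int \<Rightarrow> real) \<Rightarrow> bool" where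
  "LCC a p q c h d \<longleftrightarrow>
    (\<forall>lam\<in>- \<real>. \<forall>\<alpha>\<in>{0..<pi}. converges_to_circle a (weyl_circle a p q c h d lam \<alpha>))"

definition LPC ::
  "int \<Rightarrow> (int \<Rightarrow> real) \<Rightarrow> (int \<Rightarrow> real) \<Rightarrow> (int \<Rightarrow> real) \<Rightarrow> (int \<Rightarrow> real) \<Rightarrow> (int \<Rightarrow> real) \<Rightarrow> bool" where
  "LPC a p q c h d \<longleftrightarrow>
    (\<forall>lam\<in>- \<real>. \<forall>\<alpha>\<in>{0..<pi}. converges_to_point a (weyl_circle a p q c h d lam \<alpha>))"

definition two_l2_solutions ::
  "int \<Rightarrow> (int \<Rightarrow> real) \<Rightarrow> (int \<Rightarrow> real) \<Rightarrow> (int \<Rightarrow> real) \<Rightarrow> (int \<Rightarrow> real) \<Rightarrow> (int \<Rightarrow> real) \<Rightarrow>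
    complex \<Rightarrow> bool" where
  "two_l2_solutions a p q c h d lam \<longleftrightarrow>
    (\<exists>y z. solution a p q c h d lam y \<and> solution a p q c h d lam z \<and>
           y \<in> l2 a \<and> z \<in> l2 a \<and> lin_indep a y z)"

end

theory Submission
  imports Defs
begin

text \<open>
  For solutions \<open>y\<close> and \<open>z\<close> of the systems with parameters \<open>\<lambda>\<close> and \<open>\<mu>\<close>, the bracket
  \<open>y\<^sub>1(t + 1) z\<^sup>[\<^sup>1\<^sup>](t) - y\<^sup>[\<^sup>1\<^sup>](t) z\<^sub>1(t + 1)\<close> changes from \<open>t - 1\<close> to \<open>t\<close> by
  \<open>(\<lambda> - \<mu>) (y\<^sub>1 z\<^sub>1 + y\<^sub>2 z\<^sub>2)(t)\<close> (\<open>bracket_step\<close>). Both halves of the theorem rest on this identity.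

  \<^emph>\<open>Geometry for fixed nonreal \<open>\<lambda>\<close>.\<close> Taking \<open>z\<close> to be the conjugate of \<open>y\<close>, the identity turns
  \<open>Im (y\<^sub>1(N + 1) cnj (y\<^sup>[\<^sup>1\<^sup>](N)))\<close> into the initial value of that expression plus \<open>Im \<lambda>\<close> times the sum of
  \<open>\<bar>y(t)\<bar>\<^sup>2\<close> over \<open>a \<le> t \<le> N\<close>. For \<open>y = \<phi> + m \<psi>\<close> this expression vanishes exactly on the Weyl circle,
  so that the Weyl disc consists of the \<open>m\<close> for which the sum is at most \<open>Im m / Im \<lambda>\<close>, and its
  radius is the reciprocal of \<open>2 \<bar>Im \<lambda>\<bar>\<close> times the sum of \<open>\<bar>\<psi>(t)\<bar>\<^sup>2\<close> (\<open>weyl_circle_sphere\<close>). The discs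
  are nested, hence their intersection is a disc whose radius is the limit of the radii; it is positive
  if and only if \<open>\<psi>\<close> is square summable. The centre \<open>w\<close> of the limit disc lies in all discs, so
  \<open>\<phi> + w \<psi>\<close> is always square summable (\<open>weyl_discs_limit\<close>). If the limit is not a point, then
  \<open>\<phi> + w \<psi>\<close> and \<open>\<psi>\<close> are two independent square summable solutions. This gives the limit point case.

  \<^emph>\<open>Change of \<open>\<lambda>\<close>.\<close> Let \<open>\<lambda>\<^sub>0\<close> have two independent square summable solutions. As \<open>\<lambda>\<^sub>0\<close> avoids
  the values of \<open>M\<close>, initial value problems for \<open>\<lambda>\<^sub>0\<close> have at most one solution, so that the bracket of
  the two is a nonzero constant and a solution for \<open>\<lambda>\<close> can be expanded in them by variation of
  constants, using the pair \<open>(y\<^sub>1(t + 1), y\<^sup>[\<^sup>1\<^sup>](t))\<close>. The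
  coefficients at \<open>t - 1\<close> give \<open>y\<^sub>1(t)\<close>, whereas those at \<open>t\<close> give \<open>y\<^sub>2(t)\<close> up to the bounded factor
  \<open>(M(t) - \<lambda>\<^sub>0) / (M(t) - \<lambda>)\<close>. The coefficients therefore satisfy an implicit recursion with summable
  weights, which keeps them bounded (\<open>l2_transfer\<close>). Hence all solutions for every nonreal \<open>\<lambda>\<close> are
  square summable, which is the limit circle case.
\<close>

section \<open>Discs, spheres and discrete sums\<close>

text \<open>The centre \<open>w\<close> of any sphere through the four points \<open>z \<plusminus> r\<close> and \<open>z \<plusminus> \<i> r\<close> is \<open>z\<close>.\<close>

lemma disc_of_sphere:
  assumes "r > 0"
  shows "disc_of (sphere z r) = cball z r"
proof -
  have "w = z \<and> s = r" if "s > 0" and eq: "sphere z r = sphere w s" for w s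
  proof -
    have on: "cmod (w - x) = s" if "cmod (z - x) = r" for x
      using that eq by (auto simp: sphere_def dist_norm)
    define k where "k = w - z"
    have "cmod (k - r) = s" "cmod (k + r) = s" "cmod (k - \<i> * r) = s" "cmod (k + \<i> * r) = s"
      using on[of "z + r"] on[of "z - r"] on[of "z + \<i> * r"] on[of "z - \<i> * r"] assms
      by (simp_all add: k_def norm_mult algebra_simps)
    then have sq: "(cmod (k - r))\<^sup>2 = s\<^sup>2" "(cmod (k + r))\<^sup>2 = s\<^sup>2"
      "(cmod (k - \<i> * r))\<^sup>2 = s\<^sup>2" "(cmod (k + \<i> * r))\<^sup>2 = s\<^sup>2"
      by simp_all
    have "Re k * r = 0" "Im k * r = 0"
      using sq unfolding cmod_power2 by (simp_all add: power2_eq_square) algebra+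
    then have "k = 0"
      using assms by (simp add: complex_eq_iff)
    with \<open>cmod (k - r) = s\<close> assms show ?thesis by (simp add: k_def)
  qed
  then show ?thesis
    using assms unfolding disc_of_def by blast
qed

text \<open>Nested discs satisfy \<open>\<bar>z m - z n\<bar> \<le> r m - r n\<close>, so that centres converge because radii do;
  the limits bound exactly the points common to all discs.\<close>

lemma nested_cballs:
  fixes z :: "nat \<Rightarrow> complex" and r :: "nat \<Rightarrow> real"
  assumes pos: "\<And>n. r n > 0"
    and nested: "\<And>m n. m \<le> n \<Longrightarrow> cball (z n) (r n) \<subseteq> cball (z m) (r m)"
  obtains w \<rho> where "r \<longlonglongrightarrow> \<rho>" "\<And>n. \<rho> \<le> r n" "0 \<le> \<rho>" "(\<Inter>n. cball (z n) (r n)) = cball w \<rho>"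
proof -
  have dist: "dist (z n) (z m) + r n \<le> r m" if "m \<le> n" for m n
    using nested[OF that] pos[of n] by (auto simp: cball_subset_cball_iff)
  have "decseq r"
    unfolding decseq_def using dist by (smt (verit) zero_le_dist)
  moreover have "\<forall>n. 0 \<le> r n" using pos less_imp_le by blast
  ultimately obtain \<rho> where \<rho>: "r \<longlonglongrightarrow> \<rho>" "\<forall>n. \<rho> \<le> r n"
    using decseq_convergent[of r 0] by blast
  have "0 \<le> \<rho>" using \<rho>(1) \<open>\<forall>n. 0 \<le> r n\<close> LIMSEQ_le_const by blast
  have "Cauchy z"
  proof (rule metric_CauchyI)
    fix e :: real assume "e > 0"
    with \<rho>(1) obtain K where K: "\<And>n. n \<ge> K \<Longrightarrow> r n < \<rho> + e"
      by (metis (no_types, lifting) eventually_sequentially less_add_same_cancel1 order_tendstoD(2))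
    have *: "dist (z n) (z m) < e" if "K \<le> m" "m \<le> n" for m n
      using dist[of m n] that K[of m] \<rho>(2) by (smt (verit))
    show "\<exists>M. \<forall>m\<ge>M. \<forall>n\<ge>M. dist (z m) (z n) < e"
      using * by (metis dist_commute nle_le)
  qed
  then obtain w where w: "z \<longlonglongrightarrow> w"
    by (meson Cauchy_convergent_iff convergent_def)
  have wdist: "dist w (z m) + \<rho> \<le> r m" for m
  proof (rule LIMSEQ_le_const2)
    show "(\<lambda>n. dist (z n) (z m) + r n) \<longlonglongrightarrow> dist w (z m) + \<rho>"
      by (intro tendsto_intros w \<rho>)
    show "\<exists>N. \<forall>n\<ge>N. dist (z n) (z m) + r n \<le> r m" using dist by blast
  qed
  have "(\<Inter>n. cball (z n) (r n)) = cball w \<rho>"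
  proof (intro equalityI subsetI)
    fix x assume "x \<in> (\<Inter>n. cball (z n) (r n))"
    then have x: "dist (z n) x \<le> r n" for n by auto
    have "(\<lambda>n. dist (z n) x) \<longlonglongrightarrow> dist w x" by (intro tendsto_intros w)
    then have "dist w x \<le> \<rho>" using x LIMSEQ_le[OF _ \<rho>(1)] by blast
    then show "x \<in> cball w \<rho>" by simp
  next
    fix x assume x: "x \<in> cball w \<rho>"
    have "dist (z n) x \<le> r n" for n
      using x wdist[of n] dist_triangle[of "z n" x w] by (simp add: dist_commute)
    then show "x \<in> (\<Inter>n. cball (z n) (r n))" by auto
  qed
  with \<rho> \<open>0 \<le> \<rho>\<close> that show ?thesis by blast
qed

text \<open>Eventually \<open>e n \<le> 1/2\<close>, and then the implicit inequality gives
  \<open>g (n+1) \<le> (1 + e n) / (1 - e n) * g n \<le> exp (4 * e n) * g n\<close>; the product of these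
  factors converges because \<open>e\<close> is summable.\<close>

lemma implicit_gronwall_bounded:
  fixes g e :: "nat \<Rightarrow> real"
  assumes g: "\<And>n. 0 \<le> g n" and e: "\<And>n. 0 \<le> e n" and "summable e"
    and step: "\<And>n. g (Suc n) \<le> g n + e n * (g n + g (Suc n))"
  obtains B where "\<And>n. g n \<le> B"
proof -
  have "e \<longlonglongrightarrow> 0" using \<open>summable e\<close> by (rule summable_LIMSEQ_zero)
  then obtain T where T: "\<And>n. n \<ge> T \<Longrightarrow> e n < 1/2"
    by (metis (no_types, lifting) eventually_sequentially half_gt_zero_iff order_tendstoD(2) zero_less_one)
  have one: "g (Suc n) \<le> g n * exp (4 * e n)" if "n \<ge> T" for n
  proof -
    have "g (Suc n) * (1 - e n) \<le> g n * (1 + e n)"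
      using step[of n] by (simp add: algebra_simps)
    also have "\<dots> \<le> g n * ((1 + 4 * e n) * (1 - e n))"
    proof (rule mult_left_mono[OF _ g])
      have "e n * e n \<le> e n * (1/2)" using T[OF that] e[of n] by (intro mult_left_mono) auto
      then show "1 + e n \<le> (1 + 4 * e n) * (1 - e n)" by (simp add: algebra_simps)
    qed
    finally have "g (Suc n) \<le> g n * (1 + 4 * e n)"
      using T[OF that] by (simp flip: mult.assoc)
    also have "\<dots> \<le> g n * exp (4 * e n)"
      using g by (intro mult_left_mono) auto
    finally show ?thesis .
  qed
  have "g (T + k) \<le> g T * exp (4 * (\<Sum>i<k. e (T + i)))" for k
  proof (induction k)
    case (Suc k)
    have "g (T + Suc k) \<le> g (T + k) * exp (4 * e (T + k))" using one[of "T + k"] by simp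
    also have "\<dots> \<le> (g T * exp (4 * (\<Sum>i<k. e (T + i)))) * exp (4 * e (T + k))"
      using Suc by (intro mult_right_mono) auto
    finally show ?case by (simp add: exp_add algebra_simps)
  qed simp
  moreover have "(\<Sum>i<k. e (T + i)) \<le> suminf e" for k
  proof -
    have "(\<Sum>i<k. e (T + i)) = (\<Sum>i\<in>(+) T ` {..<k}. e i)"
      by (simp add: sum.reindex)
    also have "\<dots> \<le> suminf e" using \<open>summable e\<close> e by (intro sum_le_suminf) auto
    finally show ?thesis .
  qed
  ultimately have tail: "g (T + k) \<le> g T * exp (4 * suminf e)" for k
    using g[of T] by (meson exp_le_cancel_iff mult_left_mono mult_le_cancel_left_pos order_trans zero_less_numeral)
  have "g n \<le> g T * exp (4 * suminf e) + (\<Sum>i<T. g i)" for n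
  proof (cases "n < T")
    case True
    then have "g n \<le> (\<Sum>i<T. g i)" using g by (intro member_le_sum) auto
    then show ?thesis using g[of T] by (smt (verit) exp_gt_zero mult_nonneg_nonneg)
  next
    case False
    then show ?thesis using tail[of "n - T"] g by (smt (verit) le_add_diff_inverse not_less sum_nonneg)
  qed
  then show ?thesis using that by blast
qed

lemma norm_complex2_sq: "(norm (v :: complex ^ 2))\<^sup>2 = (cmod (v $ 1))\<^sup>2 + (cmod (v $ 2))\<^sup>2"
  by (simp add: norm_vec_def L2_set_def sum_2 real_sqrt_pow2)

definition energy :: "int \<Rightarrow> (int \<Rightarrow> complex ^ 2) \<Rightarrow> int \<Rightarrow> real" where
  "energy a y N = (\<Sum>t\<in>{a..N}. (norm (y t))\<^sup>2)"

lemma energy_mono: "M \<le> N \<Longrightarrow> energy a y M \<le> energy a y N"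
  unfolding energy_def by (intro sum_mono2) auto

lemma energy_step: "a \<le> N \<Longrightarrow> energy a y N = energy a y (N - 1) + (norm (y N))\<^sup>2"
  unfolding energy_def using atLeastAtMostPlus1_int_conv[of a "N - 1"] by simp

lemma energy_empty [simp]: "energy a y (a - 1) = 0"
  by (simp add: energy_def)

lemma energy_nat: "energy a y (a + int n) = (\<Sum>i\<le>n. (norm (y (a + int i)))\<^sup>2)"
proof (induction n)
  case (Suc n)
  then show ?case using energy_step[of a "a + int (Suc n)" y] by (simp add: algebra_simps)
qed (simp add: energy_def)

lemma l2_iff_summable: "y \<in> l2 a \<longleftrightarrow> summable (\<lambda>n. (norm (y (a + int n)))\<^sup>2)"
proof -
  have "bij_betw (\<lambda>n. a + int n) UNIV {a..}"
    by (rule bij_betwI[where g = "\<lambda>t. nat (t - a)"]) auto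
  from summable_on_reindex_bij_betw[OF this, of "\<lambda>t. (norm (y t))\<^sup>2"] show ?thesis
    by (simp add: l2_def summable_on_UNIV_nonneg_real_iff)
qed

lemma l2_iff_energy_bounded: "y \<in> l2 a \<longleftrightarrow> (\<exists>B. \<forall>N>a. energy a y N \<le> B)"
proof
  assume "y \<in> l2 a"
  then have sm: "summable (\<lambda>n. (norm (y (a + int n)))\<^sup>2)" by (simp add: l2_iff_summable)
  have "energy a y N \<le> (\<Sum>n. (norm (y (a + int n)))\<^sup>2)" if "N > a" for N
    using energy_nat[of a y "nat (N - a)"] that sum_le_suminf[OF sm, of "{..nat (N - a)}"] by simp
  then show "\<exists>B. \<forall>N>a. energy a y N \<le> B" by blast
next
  assume "\<exists>B. \<forall>N>a. energy a y N \<le> B"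
  then obtain B where B: "\<And>N. N > a \<Longrightarrow> energy a y N \<le> B" by blast
  have "(\<Sum>i<n. (norm (y (a + int i)))\<^sup>2) \<le> B" for n
  proof -
    have "(\<Sum>i<n. (norm (y (a + int i)))\<^sup>2) \<le> (\<Sum>i\<le>Suc n. (norm (y (a + int i)))\<^sup>2)"
      by (intro sum_mono2) auto
    also have "\<dots> \<le> B" using B[of "a + int (Suc n)"] by (simp add: energy_nat[symmetric])
    finally show ?thesis .
  qed
  then show "y \<in> l2 a"
    unfolding l2_iff_summable by (intro summableI_nonneg_bounded[where x = B]) auto
qed

section \<open>Circles cut out by a Hermitian form\<close>

text \<open>Multiply the left-hand side by \<open>4 J\<close> with \<open>J = Im (v * cnj V)\<close> and complete the square: with
  \<open>k = cnj v * U - u * cnj V\<close> the result is \<open>\<bar>2 J m + \<i> k\<bar>\<^sup>2 - \<bar>u V - U v\<bar>\<^sup>2\<close>. The radius of the circle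
  on which the form vanishes thus depends on \<open>J\<close> alone.\<close>

lemma Im_form_complete_square:
  fixes u v U V m :: complex
  assumes det: "u * V - U * v = 1" and J: "Im (v * cnj V) \<noteq> 0"
  shows "Im ((u + m * v) * cnj (U + m * V)) = Im (v * cnj V) *
    ((dist (- \<i> * (cnj v * U - u * cnj V) / of_real (2 * Im (v * cnj V))) m)\<^sup>2
       - (1 / (2 * \<bar>Im (v * cnj V)\<bar>))\<^sup>2)"
proof -
  define J where "J = Im (v * cnj V)"
  have J_nonzero: "J \<noteq> 0" using J unfolding J_def .
  define k where "k = cnj v * U - u * cnj V"
  have "4 * J * Im ((u + m * v) * cnj (U + m * V))
      = (cmod (of_real (2 * J) * m + \<i> * k))\<^sup>2 - (cmod (u * V - U * v))\<^sup>2"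
    unfolding cmod_power2 k_def J_def by (simp add: power2_eq_square algebra_simps)
  also have "of_real (2 * J) * m + \<i> * k = - of_real (2 * J) * (- \<i> * k / of_real (2 * J) - m)"
  proof -
    have "complex_of_real (2 * J) \<noteq> 0" unfolding of_real_eq_0_iff using J_nonzero by simp
    then show ?thesis by (simp add: field_simps)
  qed
  also have "(cmod (- of_real (2 * J) * (- \<i> * k / of_real (2 * J) - m)))\<^sup>2
      = 4 * J\<^sup>2 * (dist (- \<i> * k / of_real (2 * J)) m)\<^sup>2"
    unfolding norm_mult by (simp add: power_mult_distrib dist_norm)
  finally have *: "4 * J * Im ((u + m * v) * cnj (U + m * V))
      = 4 * J\<^sup>2 * (dist (- \<i> * k / of_real (2 * J)) m)\<^sup>2 - 1"
    using det by simp
  have "4 * J * (J * ((dist (- \<i> * k / of_real (2 * J)) m)\<^sup>2 - (1 / (2 * \<bar>J\<bar>))\<^sup>2))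
      = 4 * J\<^sup>2 * (dist (- \<i> * k / of_real (2 * J)) m)\<^sup>2 - 1"
    using J_nonzero by (simp add: power_divide power_mult_distrib power2_eq_square field_simps)
  with * have "4 * J * Im ((u + m * v) * cnj (U + m * V))
      = 4 * J * (J * ((dist (- \<i> * k / of_real (2 * J)) m)\<^sup>2 - (1 / (2 * \<bar>J\<bar>))\<^sup>2))"
    by simp
  then have "Im ((u + m * v) * cnj (U + m * V))
      = J * ((dist (- \<i> * k / of_real (2 * J)) m)\<^sup>2 - (1 / (2 * \<bar>J\<bar>))\<^sup>2)"
    using J_nonzero by (simp only: mult.assoc mult_cancel_left) simp
  then show ?thesis unfolding J_def k_def .
qed

text \<open>Both sides say that \<open>x\<close> and \<open>y\<close> are linearly dependent over the reals.\<close>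

lemma exists_angle_iff:
  "(\<exists>\<beta>\<in>{0..<pi}. x * of_real (cos \<beta>) + y * of_real (sin \<beta>) = 0) \<longleftrightarrow> Im (x * cnj y) = 0"
proof
  assume "\<exists>\<beta>\<in>{0..<pi}. x * of_real (cos \<beta>) + y * of_real (sin \<beta>) = 0"
  then obtain \<beta> where "Re x * cos \<beta> + Re y * sin \<beta> = 0" "Im x * cos \<beta> + Im y * sin \<beta> = 0"
    by (auto simp: complex_eq_iff)
  then have "(Im x * Re y - Re x * Im y) * cos \<beta> = 0" "(Im x * Re y - Re x * Im y) * sin \<beta> = 0"
    by algebra+
  moreover have "cos \<beta> \<noteq> 0 \<or> sin \<beta> \<noteq> 0"
    by (metis sin_zero_norm_cos_one norm_zero zero_neq_one)
  ultimately show "Im (x * cnj y) = 0" by auto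
next
  assume im: "Im (x * cnj y) = 0"
  show "\<exists>\<beta>\<in>{0..<pi}. x * of_real (cos \<beta>) + y * of_real (sin \<beta>) = 0"
  proof (cases "y = 0")
    case True
    then show ?thesis by (intro bexI[of _ "pi/2"]) auto
  next
    case False
    define k where "k = Re (x * cnj y) / (cmod y)\<^sup>2"
    have "x * cnj y = of_real (Re (x * cnj y))" using im by (simp add: complex_eq_iff)
    then have "x * (y * cnj y) = of_real (Re (x * cnj y)) * y" by (metis mult.assoc mult.commute)
    then have xk: "x = of_real k * y"
      using False by (simp add: k_def complex_norm_square[symmetric] field_simps)
    define \<beta> where "\<beta> = (if 0 \<le> arctan (- k) then arctan (- k) else arctan (- k) + pi)"
    have cs: "cos (arctan (- k)) \<noteq> 0" by simp
    have "sin (arctan (- k)) = - k * cos (arctan (- k))"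
      using tan_arctan[of "- k"] cs unfolding tan_def by (simp add: field_simps del: tan_arctan)
    then have "k * cos \<beta> + sin \<beta> = 0" by (simp add: \<beta>_def)
    then have "of_real (k * cos \<beta> + sin \<beta>) * y = 0" by simp
    then have "x * of_real (cos \<beta>) + y * of_real (sin \<beta>) = 0"
      unfolding xk by (simp add: algebra_simps)
    moreover have "\<beta> \<in> {0..<pi}"
      using arctan_lbound[of "- k"] arctan_ubound[of "- k"] by (auto simp: \<beta>_def)
    ultimately show ?thesis by blast
  qed
qed

section \<open>Solutions and their bracket\<close>

locale weyl_system =
  fixes a :: int and p q c h d :: "int \<Rightarrow> real"
  assumes p_nonzero: "a - 1 \<le> t \<Longrightarrow> p t \<noteq> 0"
begin

abbreviation "sol \<equiv> solution a p q c h d"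
abbreviation "qd \<equiv> quasi_deriv p c"
abbreviation "M \<equiv> M_fun p c h d"

text \<open>The bilinear Casoratian of the system; conjugating \<open>z\<close> gives its sesquilinear form.\<close>

definition bracket :: "(int \<Rightarrow> complex ^ 2) \<Rightarrow> (int \<Rightarrow> complex ^ 2) \<Rightarrow> int \<Rightarrow> complex" where
  "bracket y z t = y (t + 1) $ 1 * qd z t - qd y t * z (t + 1) $ 1"

lemma qd_eq: "qd y t = of_real (p t) * (y (t + 1) $ 1 - y t $ 1) + of_real (c t) * y t $ 2"
  by (simp add: quasi_deriv_def delta_def)

lemma sol_iff:
  "sol lam y \<longleftrightarrow>
    (\<forall>t\<ge>a. qd y t = qd y (t - 1) + (of_real (q t) - lam) * y t $ 1 + of_real (h t) * y t $ 2) \<and>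
    (\<forall>t\<ge>a - 1. of_real (c t) * (y (t + 1) $ 1 - y t $ 1) + of_real (h t) * y t $ 1
       + (of_real (d t) - lam) * y t $ 2 = 0)"
proof -
  have "(- nabla (\<lambda>s. of_real (p s) * delta (\<lambda>u. y u $ 1) s) t + of_real (q t) * y t $ 1
       - nabla (\<lambda>s. of_real (c s) * y s $ 2) t + of_real (h t) * y t $ 2 = lam * y t $ 1) \<longleftrightarrow>
     (qd y t = qd y (t - 1) + (of_real (q t) - lam) * y t $ 1 + of_real (h t) * y t $ 2)" for t
    unfolding nabla_def quasi_deriv_def by (auto simp: algebra_simps)
  moreover have "(of_real (c t) * delta (\<lambda>u. y u $ 1) t + of_real (h t) * y t $ 1
       + of_real (d t) * y t $ 2 = lam * y t $ 2) \<longleftrightarrow>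
     (of_real (c t) * (y (t + 1) $ 1 - y t $ 1) + of_real (h t) * y t $ 1
       + (of_real (d t) - lam) * y t $ 2 = 0)" for t
    unfolding delta_def by (auto simp: algebra_simps)
  ultimately show ?thesis by (simp add: solution_def Ball_def)
qed

lemma qd_linear: "qd (\<lambda>t. k *s y t + l *s z t) t = k * qd y t + l * qd z t"
  by (simp add: qd_eq algebra_simps)

lemma sol_linear: "sol lam y \<Longrightarrow> sol lam z \<Longrightarrow> sol lam (\<lambda>t. k *s y t + l *s z t)"
  unfolding sol_iff qd_linear
proof (intro conjI allI impI; elim conjE)
  fix t assume "a \<le> t"
    and "\<forall>t\<ge>a. qd y t = qd y (t - 1) + (of_real (q t) - lam) * y t $ 1 + of_real (h t) * y t $ 2"
    and "\<forall>t\<ge>a. qd z t = qd z (t - 1) + (of_real (q t) - lam) * z t $ 1 + of_real (h t) * z t $ 2"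
  then have "qd y t = qd y (t - 1) + (of_real (q t) - lam) * y t $ 1 + of_real (h t) * y t $ 2"
    "qd z t = qd z (t - 1) + (of_real (q t) - lam) * z t $ 1 + of_real (h t) * z t $ 2" by blast+
  then show "k * qd y t + l * qd z t = k * qd y (t - 1) + l * qd z (t - 1)
      + (of_real (q t) - lam) * (k *s y t + l *s z t) $ 1 + of_real (h t) * (k *s y t + l *s z t) $ 2"
    unfolding vector_add_component vector_smult_component by algebra
next
  fix t assume "a - 1 \<le> t"
    and "\<forall>t\<ge>a - 1. of_real (c t) * (y (t + 1) $ 1 - y t $ 1) + of_real (h t) * y t $ 1
       + (of_real (d t) - lam) * y t $ 2 = 0"
    and "\<forall>t\<ge>a - 1. of_real (c t) * (z (t + 1) $ 1 - z t $ 1) + of_real (h t) * z t $ 1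
       + (of_real (d t) - lam) * z t $ 2 = 0"
  then have "of_real (c t) * (y (t + 1) $ 1 - y t $ 1) + of_real (h t) * y t $ 1
       + (of_real (d t) - lam) * y t $ 2 = 0"
    "of_real (c t) * (z (t + 1) $ 1 - z t $ 1) + of_real (h t) * z t $ 1
       + (of_real (d t) - lam) * z t $ 2 = 0" by blast+
  then have "k * (of_real (c t) * (y (t + 1) $ 1 - y t $ 1) + of_real (h t) * y t $ 1
       + (of_real (d t) - lam) * y t $ 2) + l * (of_real (c t) * (z (t + 1) $ 1 - z t $ 1)
       + of_real (h t) * z t $ 1 + (of_real (d t) - lam) * z t $ 2) = 0" by simp
  then show "of_real (c t) * ((k *s y (t + 1) + l *s z (t + 1)) $ 1 - (k *s y t + l *s z t) $ 1)
      + of_real (h t) * (k *s y t + l *s z t) $ 1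
      + (of_real (d t) - lam) * (k *s y t + l *s z t) $ 2 = 0"
    by (simp add: algebra_simps)
qed

lemma qd_cnj: "qd (\<lambda>t. \<chi> i. cnj (y t $ i)) t = cnj (qd y t)"
  by (simp add: qd_eq)

lemma sol_cnj: "sol lam y \<Longrightarrow> sol (cnj lam) (\<lambda>t. \<chi> i. cnj (y t $ i))"
  unfolding sol_iff qd_cnj
proof (elim conjE, intro conjI allI impI)
  fix t assume "a \<le> t"
    and "\<forall>t\<ge>a. qd y t = qd y (t - 1) + (of_real (q t) - lam) * y t $ 1 + of_real (h t) * y t $ 2"
  then show "cnj (qd y t) = cnj (qd y (t - 1)) + (of_real (q t) - cnj lam) * (\<chi> i. cnj (y t $ i)) $ 1
      + of_real (h t) * (\<chi> i. cnj (y t $ i)) $ 2" by simp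
next
  fix t assume "a - 1 \<le> t"
    and "\<forall>t\<ge>a - 1. of_real (c t) * (y (t + 1) $ 1 - y t $ 1) + of_real (h t) * y t $ 1
       + (of_real (d t) - lam) * y t $ 2 = 0"
  then have "cnj (of_real (c t) * (y (t + 1) $ 1 - y t $ 1) + of_real (h t) * y t $ 1
       + (of_real (d t) - lam) * y t $ 2) = 0" by (metis complex_cnj_zero)
  then show "of_real (c t) * ((\<chi> i. cnj (y (t + 1) $ i)) $ 1 - (\<chi> i. cnj (y t $ i)) $ 1)
      + of_real (h t) * (\<chi> i. cnj (y t $ i)) $ 1
      + (of_real (d t) - cnj lam) * (\<chi> i. cnj (y t $ i)) $ 2 = 0" by simp
qed

text \<open>Lagrange identity in local form. In \<open>bracket y z t - bracket y z (t - 1)\<close> the terms with \<open>p\<close>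
  and \<open>q\<close> cancel by symmetry, and those with \<open>c\<close> are traded for \<open>y\<^sub>2 z\<^sub>2\<close> and \<open>h\<close>-terms by the
  second equation; the \<open>h\<close>-terms then cancel as well.\<close>

lemma bracket_step:
  assumes "sol lam y" "sol mu z" "a \<le> t"
  shows "bracket y z t = bracket y z (t - 1) + (lam - mu) * (y t $ 1 * z t $ 1 + y t $ 2 * z t $ 2)"
proof -
  have "qd y t = qd y (t - 1) + (of_real (q t) - lam) * y t $ 1 + of_real (h t) * y t $ 2"
    "qd z t = qd z (t - 1) + (of_real (q t) - mu) * z t $ 1 + of_real (h t) * z t $ 2"
    "of_real (c t) * (y (t + 1) $ 1 - y t $ 1) + of_real (h t) * y t $ 1
       + (of_real (d t) - lam) * y t $ 2 = 0"
    "of_real (c t) * (z (t + 1) $ 1 - z t $ 1) + of_real (h t) * z t $ 1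
       + (of_real (d t) - mu) * z t $ 2 = 0"
    "qd y t = of_real (p t) * (y (t + 1) $ 1 - y t $ 1) + of_real (c t) * y t $ 2"
    "qd z t = of_real (p t) * (z (t + 1) $ 1 - z t $ 1) + of_real (c t) * z t $ 2"
    using assms by (auto simp: sol_iff qd_eq[of _ t])
  then show ?thesis
    unfolding bracket_def by (simp only: diff_add_cancel) algebra
qed

lemma bracket_const:
  assumes "sol lam y" "sol lam z" "a - 1 \<le> t"
  shows "bracket y z t = bracket y z (a - 1)"
  using \<open>a - 1 \<le> t\<close>
proof (induction t rule: int_ge_induct)
  case (step t)
  then show ?case using bracket_step[OF assms(1,2), of "t + 1"] by simp
qed simp

text \<open>This is the Lagrange identity for \<open>y\<close> and its conjugate, summed from \<open>a\<close> to \<open>N\<close>.\<close>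

lemma sol_energy_identity:
  assumes "sol lam y" "a - 1 \<le> N"
  shows "Im (y (N + 1) $ 1 * cnj (qd y N)) =
    Im (y a $ 1 * cnj (qd y (a - 1))) + Im lam * energy a y N"
  using \<open>a - 1 \<le> N\<close>
proof (induction N rule: int_ge_induct)
  case (step N)
  let ?z = "\<lambda>t. (\<chi> i. cnj (y t $ i)) :: complex ^ 2"
  have br: "bracket y ?z t = of_real (2 * Im (y (t + 1) $ 1 * cnj (qd y t))) * \<i>" for t
    unfolding bracket_def qd_cnj by (simp add: complex_eq_iff)
  have "Im (bracket y ?z (N + 1)) = Im (bracket y ?z N) + 2 * Im lam * (norm (y (N + 1)))\<^sup>2"
  proof -
    have "y (N + 1) $ 1 * ?z (N + 1) $ 1 + y (N + 1) $ 2 * ?z (N + 1) $ 2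
        = of_real ((norm (y (N + 1)))\<^sup>2)"
      unfolding norm_complex2_sq of_real_add complex_norm_square by simp
    then show ?thesis
      using bracket_step[OF assms(1) sol_cnj[OF assms(1)], of "N + 1"] step.hyps by simp
  qed
  then show ?case
    using step energy_step[of a "N + 1" y] unfolding br by (simp add: algebra_simps)
qed simp

text \<open>Both the forward step from \<open>(y\<^sub>1(t), y\<^sup>[\<^sup>1\<^sup>](t - 1))\<close> and the backward step from
  \<open>(y\<^sub>1(t + 1), y\<^sup>[\<^sup>1\<^sup>](t))\<close> solve a two-by-two linear system with this determinant, so
  the initial value problem is well posed as long as \<open>lam\<close> avoids the values of \<open>M\<close>.\<close>

lemma p_M_minus:
  assumes "a - 1 \<le> t"
  shows "of_real (p t) * (of_real (M t) - lam) = of_real (p t) * (of_real (d t) - lam :: complex)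
    - of_real (c t) * of_real (c t) + of_real (h t) * of_real (c t)"
proof -
  have "p t * M t = p t * d t - c t * c t + h t * c t"
    using p_nonzero[OF assms] by (simp add: M_fun_def field_simps power2_eq_square)
  then have "complex_of_real (p t * M t) = of_real (p t * d t - c t * c t + h t * c t)" by simp
  then show ?thesis by (simp add: algebra_simps)
qed

text \<open>Read backwards, the system determines \<open>y t\<close> from \<open>y\<^sub>1 (t + 1)\<close> and \<open>y\<^sup>[\<^sup>1\<^sup>] t\<close>, and \<open>lam\<close>
  enters only through the factor \<open>M t - lam\<close>. Since the right-hand side is the same for all \<open>lam\<close>,
  solutions for different parameters can be compared.\<close>

lemma sol_second_component:
  assumes "sol lam y" "a - 1 \<le> t"
  shows "of_real (p t) * (of_real (M t) - lam) * y t $ 2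
    = of_real (h t - c t) * qd y t - of_real (h t * p t) * y (t + 1) $ 1"
proof -
  have "of_real (c t) * (y (t + 1) $ 1 - y t $ 1) + of_real (h t) * y t $ 1
     + (of_real (d t) - lam) * y t $ 2 = 0" using assms by (auto simp: sol_iff)
  then show ?thesis
    unfolding p_M_minus[OF assms(2)] qd_eq of_real_diff of_real_mult by algebra
qed

lemma sol_unique_zero:
  assumes "sol lam y" "\<And>t. a - 1 \<le> t \<Longrightarrow> lam \<noteq> of_real (M t)"
    and "y a $ 1 = 0" "qd y (a - 1) = 0" "a - 1 \<le> t"
  shows "y t = 0"
proof -
  have backwards: "y t = 0" if t: "a - 1 \<le> t" "y (t + 1) $ 1 = 0" "qd y t = 0" for t
  proof -
    have "y t $ 2 = 0"
      using sol_second_component[OF assms(1) t(1)] t assms(2)[OF t(1)] p_nonzero[OF t(1)] by simp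
    moreover have "y t $ 1 = 0"
      using qd_eq[of y t] t p_nonzero[OF t(1)] calculation by simp
    ultimately show ?thesis by (simp add: vec_eq_iff forall_2)
  qed
  \<comment> \<open>The zero data propagate forwards; \<open>backwards\<close> then recovers \<open>y t\<close>, including \<open>t = a - 1\<close>.\<close>
  have "y (t + 1) $ 1 = 0 \<and> qd y t = 0"
    using \<open>a - 1 \<le> t\<close>
  proof (induction t rule: int_ge_induct)
    case (step t)
    let ?s = "t + 1"
    have s: "a - 1 \<le> ?s" "a \<le> ?s" using step.hyps by auto
    have y1: "y ?s $ 1 = 0" using step by simp
    have q: "qd y ?s = of_real (h ?s) * y ?s $ 2"
      using assms(1) step s y1 by (auto simp: sol_iff)
    have e: "of_real (c ?s) * y (?s + 1) $ 1 + (of_real (d ?s) - lam) * y ?s $ 2 = 0"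
      using assms(1) s y1 unfolding sol_iff by (metis diff_zero mult_zero_right add.right_neutral)
    have e2: "of_real (p ?s) * y (?s + 1) $ 1 + of_real (c ?s) * y ?s $ 2 = of_real (h ?s) * y ?s $ 2"
      using q qd_eq[of y ?s] y1 by simp
    have "of_real (p ?s) * (of_real (M ?s) - lam) * y ?s $ 2 = 0"
      using e e2 unfolding p_M_minus[OF s(1)] by algebra
    then have "y ?s $ 2 = 0" using assms(2)[OF s(1)] p_nonzero[OF s(1)] by simp
    then show ?case using q e2 p_nonzero[OF s(1)] by simp
  qed (use assms in simp)
  then show ?thesis using backwards[OF \<open>a - 1 \<le> t\<close>] by simp
qed

lemma lin_indep_if_bracket:
  assumes "bracket y z (a - 1) \<noteq> 0"
  shows "lin_indep a y z"
  unfolding lin_indep_def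
proof (intro allI impI)
  fix k l :: complex assume zero: "\<forall>t\<in>{a - 1..}. k *s y t + l *s z t = 0"
  have "k *s y a + l *s z a = 0" using zero by simp
  then have "(k *s y a + l *s z a) $ 1 = 0" by simp
  then have 1: "k * y a $ 1 + l * z a $ 1 = 0" by simp
  have "qd (\<lambda>t. k *s y t + l *s z t) (a - 1) = 0" using zero unfolding qd_eq by simp
  then have 2: "k * qd y (a - 1) + l * qd z (a - 1) = 0" unfolding qd_linear .
  have "k * bracket y z (a - 1) = 0" "l * bracket y z (a - 1) = 0"
    using 1 2 unfolding bracket_def by (simp_all del: mult_eq_0_iff) algebra+
  then show "k = 0 \<and> l = 0" using assms by simp
qed

text \<open>A vanishing bracket makes the initial data linearly dependent, and by uniqueness the same relation
  then holds between the solutions.\<close>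

lemma bracket_nonzero_if_lin_indep:
  assumes "sol lam y" "sol lam z" "\<And>t. a - 1 \<le> t \<Longrightarrow> lam \<noteq> of_real (M t)" "lin_indep a y z"
  shows "bracket y z (a - 1) \<noteq> 0"
proof
  assume "bracket y z (a - 1) = 0"
  then have det: "y a $ 1 * qd z (a - 1) - qd y (a - 1) * z a $ 1 = 0" by (simp add: bracket_def)
  have dep: "k = 0 \<and> l = 0"
    if "k * y a $ 1 + l * z a $ 1 = 0" "k * qd y (a - 1) + l * qd z (a - 1) = 0" for k l
  proof -
    have "k *s y t + l *s z t = 0" if "a - 1 \<le> t" for t
      using sol_unique_zero[OF sol_linear[OF assms(1,2)] assms(3), of k l t] that
        \<open>k * y a $ 1 + l * z a $ 1 = 0\<close> \<open>k * qd y (a - 1) + l * qd z (a - 1) = 0\<close>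
      by (simp add: qd_linear)
    then show ?thesis using assms(4) unfolding lin_indep_def by auto
  qed
  have "z a $ 1 = 0 \<and> - y a $ 1 = 0" by (rule dep) (use det in \<open>simp_all add: algebra_simps\<close>)
  moreover have "qd z (a - 1) = 0 \<and> - qd y (a - 1) = 0" by (rule dep) (use det in \<open>simp_all add: algebra_simps\<close>)
  ultimately show False using dep[of 1 0] by simp
qed

lemma ivp_exists:
  assumes lam: "\<And>t. a - 1 \<le> t \<Longrightarrow> lam \<noteq> of_real (M t)"
  shows "\<exists>y. sol lam y \<and> y a $ 1 = u \<and> qd y (a - 1) = v"
proof -
  define D where "D t = of_real (p t) * (of_real (M t) - lam)" for t
  have D0: "D t \<noteq> 0" if "a - 1 \<le> t" for t using lam[OF that] p_nonzero[OF that] by (auto simp: D_def)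
  have DM: "D t = of_real (p t) * (of_real (d t) - lam) - of_real (c t) * of_real (c t)
      + of_real (h t) * of_real (c t)" if "a - 1 \<le> t" for t
    unfolding D_def by (rule p_M_minus[OF that])
  \<comment> \<open>The state \<open>s = (y\<^sub>1(t), y\<^sup>[\<^sup>1\<^sup>](t - 1))\<close> determines \<open>y\<^sub>2(t)\<close> and the next state. At \<open>t = a - 1\<close>, where
    the first equation is not imposed, \<open>(e1, e2)\<close> comes from the backward step instead.\<close>
  define w where "w t s = snd s + (of_real (q t) - lam) * fst s" for t and s :: "complex \<times> complex"
  define y2 where "y2 t s = - (of_real (h t) * fst s * of_real (p t) + of_real (c t) * w t s) / D t"
    for t and s :: "complex \<times> complex"
  define nxt where "nxt t s = (fst s + (w t s + (of_real (h t) - of_real (c t)) * y2 t s) / of_real (p t),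
      w t s + of_real (h t) * y2 t s)" for t and s :: "complex \<times> complex"
  define st where "st = rec_nat (u, v) (\<lambda>n s. nxt (a + int n) s)"
  have st: "st 0 = (u, v)" "st (Suc n) = nxt (a + int n) (st n)" for n by (simp_all add: st_def)
  define e2 where "e2 = (of_real (h (a - 1) - c (a - 1)) * v
      - of_real (h (a - 1) * p (a - 1)) * u) / D (a - 1)"
  define e1 where "e1 = u - (v - of_real (c (a - 1)) * e2) / of_real (p (a - 1))"
  define y :: "int \<Rightarrow> complex ^ 2" where
    "y t = (if a \<le> t then vector [fst (st (nat (t - a))), y2 t (st (nat (t - a)))] else vector [e1, e2])" for t
  have ya: "y (a - 1) $ 1 = e1" "y (a - 1) $ 2 = e2" "y a $ 1 = u" by (simp_all add: y_def st)
  have p0: "complex_of_real (p t) \<noteq> 0" if "a - 1 \<le> t" for t using p_nonzero[OF that] by simp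
  have qa: "qd y (a - 1) = v" unfolding qd_eq using ya p0[of "a - 1"] by (simp add: e1_def)
  have cur: "y t $ 1 = fst (st (nat (t - a)))" "y t $ 2 = y2 t (st (nat (t - a)))" if "a \<le> t" for t
    using that by (simp_all add: y_def)
  have nx: "st (nat (t + 1 - a)) = nxt t (st (nat (t - a)))" if "a \<le> t" for t
  proof -
    have "nat (t + 1 - a) = Suc (nat (t - a))" using that by simp
    then show ?thesis using st(2)[of "nat (t - a)"] that by simp
  qed
  have q1: "qd y t = w t (st (nat (t - a))) + of_real (h t) * y t $ 2" if "a \<le> t" for t
    unfolding qd_eq using that p0[of t] cur[of "t + 1"] cur[of t] nx[of t]
    by (simp add: nxt_def field_simps)
  have sq: "snd (st (nat (t - a))) = qd y (t - 1)" if "a \<le> t" for t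
  proof (cases "t = a")
    case False
    then have "st (nat (t - a)) = nxt (t - 1) (st (nat (t - 1 - a)))" using nx[of "t - 1"] that by simp
    then show ?thesis using q1[of "t - 1"] cur[of "t - 1"] that False by (simp add: nxt_def)
  qed (simp add: st qa)
  have "sol lam y"
    unfolding sol_iff
  proof (intro conjI allI impI)
    fix t assume "a \<le> t"
    then show "qd y t = qd y (t - 1) + (of_real (q t) - lam) * y t $ 1 + of_real (h t) * y t $ 2"
      using q1[of t] sq[of t] cur[of t] by (simp add: w_def)
  next
    fix t assume t: "a - 1 \<le> t"
    have "of_real (p t) * (of_real (c t) * (y (t + 1) $ 1 - y t $ 1) + of_real (h t) * y t $ 1
        + (of_real (d t) - lam) * y t $ 2) = 0"
    proof (cases "a \<le> t")
      case True
      have "D t * y t $ 2 = - (of_real (h t) * y t $ 1 * of_real (p t)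
          + of_real (c t) * w t (st (nat (t - a))))"
        using D0[OF t] cur[OF True] by (simp add: y2_def)
      then show ?thesis using q1[OF True] unfolding DM[OF t] qd_eq by algebra
    next
      case False
      then have ta: "t = a - 1" using t by simp
      have "D t * y t $ 2 = of_real (h t - c t) * qd y t - of_real (h t * p t) * y (t + 1) $ 1"
        using D0[OF t] ya qa by (simp add: e2_def ta)
      then show ?thesis unfolding DM[OF t] qd_eq of_real_diff of_real_mult by algebra
    qed
    then show "of_real (c t) * (y (t + 1) $ 1 - y t $ 1) + of_real (h t) * y t $ 1
        + (of_real (d t) - lam) * y t $ 2 = 0" using p0[OF t] by simp
  qed
  with ya qa show ?thesis by blast
qed

section \<open>Independence of the spectral parameter\<close>

text \<open>Variation of constants. Write \<open>(y\<^sub>1(t + 1), y\<^sup>[\<^sup>1\<^sup>](t))\<close> as the combination of the corresponding pairs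
  of \<open>\<theta>\<close> and \<open>\<eta>\<close> with coefficients \<open>A t\<close> and \<open>B t\<close>. By the Lagrange identity the increments of
  \<open>A\<close> and \<open>B\<close> at \<open>t\<close> are of size \<open>\<bar>y(t)\<bar> s(t)\<close>, where \<open>s = \<bar>\<theta>\<bar> + \<bar>\<eta>\<bar>\<close> is square summable, and
  \<open>\<bar>y(t)\<bar>\<close> is at most a multiple of \<open>s(t)\<close> times the size of the coefficients at \<open>t - 1\<close> and \<open>t\<close>.
  Reading \<open>y\<^sub>1(t)\<close> off the coefficients at \<open>t - 1\<close> and \<open>y\<^sub>2(t)\<close> off those at \<open>t\<close> is essential: every
  other choice brings in correction terms such as \<open>c(t) / p(t)\<close>, which may be unbounded.\<close>

lemma l2_transfer:
  assumes \<theta>: "sol lam0 \<theta>" and \<eta>: "sol lam0 \<eta>"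
    and l2: "\<theta> \<in> l2 a" "\<eta> \<in> l2 a" and "lin_indep a \<theta> \<eta>"
    and lam0: "\<And>t. a - 1 \<le> t \<Longrightarrow> lam0 \<noteq> of_real (M t)"
    and "Im lam \<noteq> 0" and y: "sol lam y"
  shows "y \<in> l2 a"
proof -
  define W where "W = bracket \<theta> \<eta> (a - 1)"
  have W: "W \<noteq> 0"
    unfolding W_def using bracket_nonzero_if_lin_indep[OF \<theta> \<eta> lam0 \<open>lin_indep a \<theta> \<eta>\<close>] .
  define A where "A t = bracket y \<eta> t / W" for t
  define B where "B t = bracket \<theta> y t / W" for t
  define G where "G t = cmod (A t) + cmod (B t)" for t
  define s where "s t = norm (\<theta> t) + norm (\<eta> t)" for t
  define K where "K = 1 + cmod (lam - lam0) / \<bar>Im lam\<bar>"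
  define C where "C = cmod (lam - lam0) / cmod W"
  have K1: "1 \<le> K" by (simp add: K_def)
  have C0: "0 \<le> C" by (simp add: C_def)
  have G0: "0 \<le> G t" and s0: "0 \<le> s t" for t by (simp_all add: G_def s_def)
  have comb1: "y (t + 1) $ 1 = A t * \<theta> (t + 1) $ 1 + B t * \<eta> (t + 1) $ 1"
    and combq: "qd y t = A t * qd \<theta> t + B t * qd \<eta> t" if "a - 1 \<le> t" for t
  proof -
    have Wt: "W = \<theta> (t + 1) $ 1 * qd \<eta> t - qd \<theta> t * \<eta> (t + 1) $ 1"
      using bracket_const[OF \<theta> \<eta> that] by (simp add: W_def bracket_def)
    have AW: "A t * W = y (t + 1) $ 1 * qd \<eta> t - qd y t * \<eta> (t + 1) $ 1"
      and BW: "B t * W = \<theta> (t + 1) $ 1 * qd y t - qd \<theta> t * y (t + 1) $ 1"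
      using W by (simp_all add: A_def B_def bracket_def)
    have "W * y (t + 1) $ 1 = W * (A t * \<theta> (t + 1) $ 1 + B t * \<eta> (t + 1) $ 1)"
      using Wt AW BW by algebra
    then show "y (t + 1) $ 1 = A t * \<theta> (t + 1) $ 1 + B t * \<eta> (t + 1) $ 1" using W by simp
    have "W * qd y t = W * (A t * qd \<theta> t + B t * qd \<eta> t)"
      using Wt AW BW by algebra
    then show "qd y t = A t * qd \<theta> t + B t * qd \<eta> t" using W by simp
  qed
  have comp: "cmod (z t $ i) \<le> norm (z t)" for z :: "int \<Rightarrow> complex ^ 2" and t i
    by (rule Finite_Cartesian_Product.norm_nth_le)
  have lin: "cmod (A r * \<theta> t $ i + B r * \<eta> t $ i) \<le> G r * s t" for r t i
  proof -
    have "cmod (A r * \<theta> t $ i + B r * \<eta> t $ i) \<le> cmod (A r) * cmod (\<theta> t $ i) + cmod (B r) * cmod (\<eta> t $ i)"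
      using norm_triangle_ineq[of "A r * \<theta> t $ i" "B r * \<eta> t $ i"] by (simp add: norm_mult)
    also have "\<dots> \<le> cmod (A r) * s t + cmod (B r) * s t"
      using comp[of \<theta> t i] comp[of \<eta> t i]
      by (intro add_mono mult_left_mono) (auto simp: s_def intro: add_increasing add_increasing2)
    finally show ?thesis by (simp add: G_def algebra_simps)
  qed
  have y1: "cmod (y t $ 1) \<le> G (t - 1) * s t" if "a \<le> t" for t
    using comb1[of "t - 1"] lin[of "t - 1" t 1] that by simp
  have y2: "cmod (y t $ 2) \<le> K * (G t * s t)" if "a - 1 \<le> t" for t
  proof -
    let ?m = "complex_of_real (M t)" and ?v = "A t * \<theta> t $ 2 + B t * \<eta> t $ 2"
    have "of_real (p t) * ((?m - lam) * y t $ 2) = of_real (p t) * ((?m - lam0) * ?v)"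
      using sol_second_component[OF y that] sol_second_component[OF \<theta> that]
        sol_second_component[OF \<eta> that] comb1[OF that] combq[OF that] by algebra
    then have eq: "(?m - lam) * y t $ 2 = (?m - lam0) * ?v" using p_nonzero[OF that] by simp
    \<comment> \<open>\<open>(M t - lam0) / (M t - lam)\<close> is bounded by \<open>K\<close> because \<open>M t\<close> is real and \<open>lam\<close> is not.\<close>
    have im: "\<bar>Im lam\<bar> \<le> cmod (?m - lam)" using abs_Im_le_cmod[of "?m - lam"] by simp
    have "cmod (?m - lam0) \<le> cmod (?m - lam) + cmod (lam - lam0)"
      using norm_triangle_ineq[of "?m - lam" "lam - lam0"] by simp
    also have "\<dots> \<le> cmod (?m - lam) * K"
    proof -
      have "cmod (lam - lam0) = \<bar>Im lam\<bar> * (cmod (lam - lam0) / \<bar>Im lam\<bar>)" using \<open>Im lam \<noteq> 0\<close> by simp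
      also have "\<dots> \<le> cmod (?m - lam) * (cmod (lam - lam0) / \<bar>Im lam\<bar>)"
        using im by (intro mult_right_mono) auto
      finally show ?thesis by (simp add: K_def algebra_simps)
    qed
    finally have "cmod (?m - lam0) * cmod ?v \<le> cmod (?m - lam) * K * cmod ?v"
      by (intro mult_right_mono) auto
    moreover have "cmod (?m - lam) * cmod (y t $ 2) = cmod (?m - lam0) * cmod ?v"
      using arg_cong[OF eq, of cmod] by (simp only: norm_mult)
    ultimately have "cmod (?m - lam) * cmod (y t $ 2) \<le> cmod (?m - lam) * (K * cmod ?v)"
      by (simp add: mult.assoc)
    then have "cmod (y t $ 2) \<le> K * cmod ?v"
      using im \<open>Im lam \<noteq> 0\<close> by (subst (asm) mult_le_cancel_left_pos) auto
    also have "\<dots> \<le> K * (G t * s t)" using lin[of t t 2] K1 by (intro mult_left_mono) auto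
    finally show ?thesis .
  qed
  have inc: "cmod ((lam - lam0) * (y t $ 1 * z t $ 1 + y t $ 2 * z t $ 2) / W)
      \<le> C * (s t)\<^sup>2 * (G (t - 1) + K * G t)"
    if "a \<le> t" "norm (z t) \<le> s t" for z :: "int \<Rightarrow> complex ^ 2" and t
  proof -
    have "cmod (y t $ 1 * z t $ 1 + y t $ 2 * z t $ 2)
        \<le> cmod (y t $ 1) * cmod (z t $ 1) + cmod (y t $ 2) * cmod (z t $ 2)"
      using norm_triangle_ineq[of "y t $ 1 * z t $ 1" "y t $ 2 * z t $ 2"] by (simp add: norm_mult)
    also have "\<dots> \<le> G (t - 1) * s t * s t + K * (G t * s t) * s t"
      using y1[of t] y2[of t] that comp[of z t 1] comp[of z t 2] G0 s0 K1
      by (intro add_mono mult_mono) (auto intro: order_trans)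
    also have "\<dots> = (s t)\<^sup>2 * (G (t - 1) + K * G t)" by (simp add: power2_eq_square algebra_simps)
    finally have "C * cmod (y t $ 1 * z t $ 1 + y t $ 2 * z t $ 2)
        \<le> C * ((s t)\<^sup>2 * (G (t - 1) + K * G t))" using C0 by (intro mult_left_mono)
    then show ?thesis by (simp add: C_def norm_mult norm_divide mult.assoc)
  qed
  have Ast: "cmod (A t) \<le> cmod (A (t - 1)) + C * (s t)\<^sup>2 * (G (t - 1) + K * G t)" if "a \<le> t" for t
  proof -
    have "A t = A (t - 1) + (lam - lam0) * (y t $ 1 * \<eta> t $ 1 + y t $ 2 * \<eta> t $ 2) / W"
      using bracket_step[OF y \<eta> that] by (simp add: A_def add_divide_distrib)
    then show ?thesis using norm_triangle_le[OF add_left_mono[OF inc[OF that, of \<eta>]], of "A (t - 1)"]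
      by (simp add: s_def)
  qed
  have Bst: "cmod (B t) \<le> cmod (B (t - 1)) + C * (s t)\<^sup>2 * (G (t - 1) + K * G t)" if "a \<le> t" for t
  proof -
    have "B t = B (t - 1) - (lam - lam0) * (y t $ 1 * \<theta> t $ 1 + y t $ 2 * \<theta> t $ 2) / W"
    proof -
      have "bracket \<theta> y t = bracket \<theta> y (t - 1)
          - (lam - lam0) * (y t $ 1 * \<theta> t $ 1 + y t $ 2 * \<theta> t $ 2)"
        using bracket_step[OF \<theta> y that] by (simp add: algebra_simps)
      then show ?thesis by (simp add: B_def diff_divide_distrib)
    qed
    then have "cmod (B t) \<le> cmod (B (t - 1)) + cmod ((lam - lam0) * (y t $ 1 * \<theta> t $ 1 + y t $ 2 * \<theta> t $ 2) / W)"
      using norm_triangle_ineq4 by metis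
    then show ?thesis using inc[OF that, of \<theta>] by (simp add: s_def)
  qed
  define e where "e n = 2 * C * K * (s (a + int n))\<^sup>2" for n
  have s_sum: "summable (\<lambda>n. (s (a + int n))\<^sup>2)"
  proof (rule summable_comparison_test')
    show "summable (\<lambda>n. 2 * (norm (\<theta> (a + int n)))\<^sup>2 + 2 * (norm (\<eta> (a + int n)))\<^sup>2)"
      using l2 unfolding l2_iff_summable by (intro summable_add summable_mult)
    show "norm ((s (a + int n))\<^sup>2) \<le> 2 * (norm (\<theta> (a + int n)))\<^sup>2 + 2 * (norm (\<eta> (a + int n)))\<^sup>2" for n
      using sum_squares_bound[of "norm (\<theta> (a + int n))" "norm (\<eta> (a + int n))"]
      by (simp add: s_def power2_sum)
  qed
  have step: "G (a + int n) \<le> G (a + int n - 1) + e n * (G (a + int n - 1) + G (a + int n))" for n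
  proof -
    let ?t = "a + int n"
    have "G ?t \<le> G (?t - 1) + 2 * C * (s ?t)\<^sup>2 * (G (?t - 1) + K * G ?t)"
      using Ast[of ?t] Bst[of ?t] by (simp add: G_def)
    also have "2 * C * (s ?t)\<^sup>2 * (G (?t - 1) + K * G ?t)
        \<le> 2 * C * (s ?t)\<^sup>2 * (K * (G (?t - 1) + G ?t))"
      using C0 K1 G0 mult_right_mono[OF K1 G0[of "?t - 1"]]
      by (intro mult_left_mono) (auto simp: algebra_simps)
    finally show ?thesis by (simp add: e_def algebra_simps)
  qed
  define g where "g n = G (a - 1 + int n)" for n
  have g: "g n = G (a + int n - 1)" "g (Suc n) = G (a + int n)" for n
    by (simp_all add: g_def algebra_simps)
  have "g (Suc n) \<le> g n + e n * (g n + g (Suc n))" for n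
    using step[of n] by (simp add: g)
  moreover have "summable e" unfolding e_def using s_sum by (rule summable_mult)
  moreover have "0 \<le> g n" "0 \<le> e n" for n
    using G0 C0 K1 by (simp_all add: g_def e_def)
  ultimately obtain b where b: "\<And>n. g n \<le> b"
    using implicit_gronwall_bounded[of g e] by blast
  have Gb: "G t \<le> b" if "a - 1 \<le> t" for t using b[of "nat (t - (a - 1))"] that by (simp add: g_def)
  have b0: "0 \<le> b" using b[of 0] G0[of "a - 1"] by (simp add: g_def)
  have "(norm (y t))\<^sup>2 \<le> 2 * (K * b)\<^sup>2 * (s t)\<^sup>2" if "a \<le> t" for t
  proof -
    have "cmod (y t $ 1) \<le> 1 * (b * s t)"
      using order_trans[OF y1[OF that] mult_right_mono[OF Gb s0]] that by simp
    also have "\<dots> \<le> K * (b * s t)" using K1 b0 s0 by (intro mult_right_mono) auto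
    finally have "(cmod (y t $ 1))\<^sup>2 \<le> (K * (b * s t))\<^sup>2" by (intro power_mono) auto
    moreover have "cmod (y t $ 2) \<le> K * (b * s t)"
      using order_trans[OF y2 mult_left_mono[OF mult_right_mono[OF Gb s0]]] that K1 by simp
    then have "(cmod (y t $ 2))\<^sup>2 \<le> (K * (b * s t))\<^sup>2" by (intro power_mono) auto
    ultimately show ?thesis by (simp add: norm_complex2_sq power_mult_distrib algebra_simps)
  qed
  then show ?thesis
    unfolding l2_iff_summable
    by (intro summable_comparison_test'[OF summable_mult[OF s_sum, of "2 * (K * b)\<^sup>2"], of 0]) auto
qed

end

section \<open>Weyl discs\<close>

locale weyl_pair = weyl_system +
  fixes lam :: complex and \<alpha> :: real
  assumes nonreal: "Im lam \<noteq> 0"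
begin

abbreviation "\<phi> \<equiv> weyl_phi a p q c h d lam \<alpha>"
abbreviation "\<psi> \<equiv> weyl_psi a p q c h d lam \<alpha>"

text \<open>The factor \<open>1 *s\<close> makes \<open>sol_linear\<close> and \<open>qd_linear\<close> apply literally.\<close>

definition weyl_comb :: "complex \<Rightarrow> int \<Rightarrow> complex ^ 2" where
  "weyl_comb m t = 1 *s \<phi> t + m *s \<psi> t"

definition radius :: "int \<Rightarrow> real" where
  "radius N = 1 / (2 * (\<bar>Im lam\<bar> * energy a \<psi> N))"

lemma lam_ne_M: "lam \<noteq> of_real (M t)"
  using nonreal by auto

lemma
  shows sol_phi: "sol lam \<phi>" and phi_a: "\<phi> a $ 1 = of_real (sin \<alpha>)"
    and qd_phi_a: "qd \<phi> (a - 1) = of_real (- cos \<alpha>)"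
  using someI_ex[OF ivp_exists[OF lam_ne_M, of "of_real (sin \<alpha>)" "of_real (- cos \<alpha>)"]]
  unfolding weyl_phi_def ivp_solution_def by blast+

lemma
  shows sol_psi: "sol lam \<psi>" and psi_a: "\<psi> a $ 1 = of_real (cos \<alpha>)"
    and qd_psi_a: "qd \<psi> (a - 1) = of_real (sin \<alpha>)"
  using someI_ex[OF ivp_exists[OF lam_ne_M, of "of_real (cos \<alpha>)" "of_real (sin \<alpha>)"]]
  unfolding weyl_psi_def ivp_solution_def by blast+

lemma sol_weyl_comb: "sol lam (weyl_comb m)"
  unfolding weyl_comb_def using sol_linear[OF sol_phi sol_psi] .

lemma weyl_comb_1: "weyl_comb m t $ 1 = \<phi> t $ 1 + m * \<psi> t $ 1"
  and qd_weyl_comb: "qd (weyl_comb m) t = qd \<phi> t + m * qd \<psi> t"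
  unfolding weyl_comb_def qd_linear by simp_all

lemma bracket_phi_psi:
  assumes "a - 1 \<le> t"
  shows "bracket \<phi> \<psi> t = 1"
proof -
  have "bracket \<phi> \<psi> (a - 1) = of_real ((sin \<alpha>)\<^sup>2 + (cos \<alpha>)\<^sup>2)"
    unfolding bracket_def using phi_a qd_phi_a psi_a qd_psi_a
    by (simp add: power2_eq_square)
  then show ?thesis using bracket_const[OF sol_phi sol_psi assms] by simp
qed

text \<open>If \<open>\<psi>\<close> vanished at both \<open>a\<close> and \<open>a + 1\<close>, its quasi-derivative at \<open>a\<close> and thus its bracket
  with \<open>\<phi>\<close> would vanish. This is where \<open>N > a\<close> rather than \<open>N \<ge> a\<close> matters: the value \<open>\<psi> a\<close> alone
  may be zero.\<close>

lemma energy_psi_pos: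
  assumes "a < N"
  shows "0 < energy a \<psi> N"
proof (rule ccontr)
  assume "\<not> 0 < energy a \<psi> N"
  then have "energy a \<psi> N = 0"
    unfolding energy_def by (meson not_less order_antisym sum_nonneg zero_le_power2)
  then have "\<psi> t = 0" if "t \<in> {a..N}" for t
    using that unfolding energy_def by (simp add: sum_nonneg_eq_0_iff)
  then have z: "\<psi> a = 0" "\<psi> (a + 1) = 0" using assms by auto
  then have "qd \<psi> a = 0" by (simp add: qd_eq)
  with z have "bracket \<phi> \<psi> a = 0" by (simp add: bracket_def)
  then show False using bracket_phi_psi[of a] by simp
qed

lemma psi_form:
  assumes "a < N"
  shows "Im (\<psi> (N + 1) $ 1 * cnj (qd \<psi> N)) = Im lam * energy a \<psi> N"
  using sol_energy_identity[OF sol_psi, of N] assms by (simp add: psi_a qd_psi_a)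

lemma weyl_comb_form:
  assumes "a < N"
  shows "Im (weyl_comb m (N + 1) $ 1 * cnj (qd (weyl_comb m) N))
    = Im lam * (energy a (weyl_comb m) N - Im m / Im lam)"
proof -
  have "Im (weyl_comb m a $ 1 * cnj (qd (weyl_comb m) (a - 1)))
      = - Im m * ((sin \<alpha>)\<^sup>2 + (cos \<alpha>)\<^sup>2)"
    unfolding weyl_comb_1 qd_weyl_comb phi_a psi_a qd_phi_a qd_psi_a
    by (simp add: power2_eq_square algebra_simps del: sin_cos_squared_add sin_cos_squared_add2 sin_cos_squared_add3)
  also have "\<dots> = - Im m" by simp
  finally show ?thesis
    using sol_energy_identity[OF sol_weyl_comb, of N m] assms nonreal by (simp add: right_diff_distrib)
qed

text \<open>The point \<open>m\<close> lies on the circle iff \<open>\<phi> + m \<psi>\<close> satisfies some real boundary condition at \<open>N\<close>,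
  that is, iff the form of \<open>weyl_comb_form\<close> vanishes. That form has the leading coefficient
  \<open>Im lam * energy a \<psi> N\<close>, so after division by \<open>Im lam\<close> it is negative inside the circle,
  whatever the sign of \<open>Im lam\<close>.\<close>

lemma weyl_circle_sphere:
  assumes "a < N"
  obtains z where "weyl_circle a p q c h d lam \<alpha> N = sphere z (radius N)"
    and "cball z (radius N) = {m. energy a (weyl_comb m) N \<le> Im m / Im lam}"
proof -
  define J where "J = Im (\<psi> (N + 1) $ 1 * cnj (qd \<psi> N))"
  have J: "J = Im lam * energy a \<psi> N" unfolding J_def by (rule psi_form[OF assms])
  have J0: "J \<noteq> 0" using J energy_psi_pos[OF assms] nonreal by simp
  have r: "radius N = 1 / (2 * \<bar>J\<bar>)"
    using energy_psi_pos[OF assms] by (simp add: radius_def J abs_mult)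
  have rpos: "0 < radius N" using J0 by (simp add: r)
  have det: "\<phi> (N + 1) $ 1 * qd \<psi> N - qd \<phi> N * \<psi> (N + 1) $ 1 = 1"
    using bracket_phi_psi[of N] assms by (simp add: bracket_def)
  obtain z where form: "\<And>m. Im (weyl_comb m (N + 1) $ 1 * cnj (qd (weyl_comb m) N))
      = J * ((dist z m)\<^sup>2 - (radius N)\<^sup>2)"
    using Im_form_complete_square[OF det J0[unfolded J_def]]
    unfolding weyl_comb_1 qd_weyl_comb r J_def by blast
  have "weyl_circle a p q c h d lam \<alpha> N = sphere z (radius N)"
  proof (rule set_eqI)
    fix m
    have psi0: "U2 p c N \<beta> \<psi> \<noteq> 0" if "\<beta> \<in> {0..<pi}" for \<beta>
      using exists_angle_iff[of "\<psi> (N + 1) $ 1" "qd \<psi> N"] J0 that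
      unfolding J_def U2_def by blast
    have lin: "U2 p c N \<beta> (weyl_comb m) = U2 p c N \<beta> \<phi> + m * U2 p c N \<beta> \<psi>" for \<beta>
      unfolding U2_def weyl_comb_1 qd_weyl_comb by (simp add: algebra_simps)
    have "m \<in> weyl_circle a p q c h d lam \<alpha> N
        \<longleftrightarrow> (\<exists>\<beta>\<in>{0..<pi}. m = - U2 p c N \<beta> \<phi> / U2 p c N \<beta> \<psi>)"
      by (auto simp: weyl_circle_def)
    also have "\<dots> \<longleftrightarrow> (\<exists>\<beta>\<in>{0..<pi}. U2 p c N \<beta> (weyl_comb m) = 0)"
    proof (intro bex_cong refl)
      fix \<beta> :: real assume "\<beta> \<in> {0..<pi}"
      from psi0[OF this] show "(m = - U2 p c N \<beta> \<phi> / U2 p c N \<beta> \<psi>) = (U2 p c N \<beta> (weyl_comb m) = 0)"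
        unfolding lin by (metis add_eq_0_iff add.commute eq_divide_eq neg_eq_iff_add_eq_0)
    qed
    also have "\<dots> \<longleftrightarrow> Im (weyl_comb m (N + 1) $ 1 * cnj (qd (weyl_comb m) N)) = 0"
      unfolding U2_def by (rule exists_angle_iff)
    also have "\<dots> \<longleftrightarrow> dist z m = radius N"
      unfolding form using J0 rpos by (simp add: power2_eq_iff_nonneg)
    finally show "m \<in> weyl_circle a p q c h d lam \<alpha> N \<longleftrightarrow> m \<in> sphere z (radius N)" by simp
  qed
  moreover have "cball z (radius N) = {m. energy a (weyl_comb m) N \<le> Im m / Im lam}"
  proof (rule set_eqI)
    fix m
    have "Im lam * (energy a (weyl_comb m) N - Im m / Im lam)
        = Im lam * (energy a \<psi> N * ((dist z m)\<^sup>2 - (radius N)\<^sup>2))"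
      unfolding weyl_comb_form[OF assms, symmetric] form J by (rule mult.assoc)
    then have "energy a (weyl_comb m) N - Im m / Im lam
        = energy a \<psi> N * ((dist z m)\<^sup>2 - (radius N)\<^sup>2)" using nonreal by simp
    then have "energy a (weyl_comb m) N \<le> Im m / Im lam \<longleftrightarrow> (dist z m)\<^sup>2 \<le> (radius N)\<^sup>2"
      using energy_psi_pos[OF assms] by (smt (verit) mult_le_0_iff zero_less_mult_iff)
    also have "\<dots> \<longleftrightarrow> dist z m \<le> radius N"
      using rpos by (simp add: power2_le_iff_abs_le)
    finally show "m \<in> cball z (radius N)
        \<longleftrightarrow> m \<in> {m. energy a (weyl_comb m) N \<le> Im m / Im lam}" by simp
  qed
  ultimately show ?thesis using that by blast
qed

text \<open>The energies grow with \<open>N\<close>, so the discs are nested, and the radii tend to a positive limit iff the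
  energies of \<open>\<psi>\<close> stay bounded. The centre of the limit disc lies in every disc, which bounds the
  energies of \<open>\<phi> + w \<psi>\<close> by \<open>Im w / Im lam\<close>.\<close>

lemma weyl_discs_limit:
  obtains w \<rho> where "0 \<le> \<rho>" "0 < \<rho> \<longleftrightarrow> \<psi> \<in> l2 a" "weyl_comb w \<in> l2 a"
    and "(\<Inter>N\<in>{a<..}. disc_of (weyl_circle a p q c h d lam \<alpha> N)) = cball w \<rho>"
proof -
  define D where "D N = {m. energy a (weyl_comb m) N \<le> Im m / Im lam}" for N
  let ?N = "\<lambda>n. a + 1 + int n"
  have "\<exists>z. weyl_circle a p q c h d lam \<alpha> N = sphere z (radius N) \<and> cball z (radius N) = D N"
    if "a < N" for N
  proof (rule weyl_circle_sphere[OF that])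
    fix z assume "weyl_circle a p q c h d lam \<alpha> N = sphere z (radius N)"
      and "cball z (radius N) = {m. energy a (weyl_comb m) N \<le> Im m / Im lam}"
    then show ?thesis unfolding D_def by (intro exI[of _ z] conjI)
  qed
  then obtain z where "\<And>N. a < N \<Longrightarrow>
      weyl_circle a p q c h d lam \<alpha> N = sphere (z N) (radius N) \<and> cball (z N) (radius N) = D N"
    by metis
  then have z: "\<And>N. a < N \<Longrightarrow> weyl_circle a p q c h d lam \<alpha> N = sphere (z N) (radius N)"
    "\<And>N. a < N \<Longrightarrow> cball (z N) (radius N) = D N" by blast+
  have rpos: "0 < radius N" if "a < N" for N
    using energy_psi_pos[OF that] nonreal by (simp add: radius_def)
  have disc: "disc_of (weyl_circle a p q c h d lam \<alpha> N) = D N" if "a < N" for N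
    using z[OF that] disc_of_sphere[OF rpos[OF that]] by simp
  have "D N \<subseteq> D K" if "K \<le> N" for K N
    unfolding D_def using energy_mono[OF that] by (intro Collect_mono impI) (rule order_trans)
  then have nested: "cball (z (?N n)) (radius (?N n)) \<subseteq> cball (z (?N m)) (radius (?N m))"
    if "m \<le> n" for m n using z(2)[of "?N n"] z(2)[of "?N m"] that by simp
  have rpos_nat: "0 < radius (?N n)" for n by (rule rpos) simp
  obtain w \<rho> where lim: "(\<lambda>n. radius (?N n)) \<longlonglongrightarrow> \<rho>" "\<And>n. \<rho> \<le> radius (?N n)" "0 \<le> \<rho>"
    and inter: "(\<Inter>n. cball (z (?N n)) (radius (?N n))) = cball w \<rho>"
    by (rule nested_cballs[of "\<lambda>n. radius (?N n)" "\<lambda>n. z (?N n)", OF rpos_nat nested]) (assumption, rule that)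
  have range: "{a<..} = range ?N"
  proof
    show "{a<..} \<subseteq> range ?N"
    proof
      fix N assume "N \<in> {a<..}"
      then have "N = ?N (nat (N - a - 1))" by simp
      then show "N \<in> range ?N" by (rule range_eqI)
    qed
  qed auto
  have "(\<Inter>N\<in>{a<..}. disc_of (weyl_circle a p q c h d lam \<alpha> N)) = (\<Inter>N\<in>{a<..}. D N)"
    using disc by auto
  also have "\<dots> = cball w \<rho>"
  proof -
    have "cball (z (?N n)) (radius (?N n)) = D (?N n)" for n by (rule z(2)) simp
    then show ?thesis unfolding inter[symmetric] range by simp
  qed
  finally have int: "(\<Inter>N\<in>{a<..}. disc_of (weyl_circle a p q c h d lam \<alpha> N)) = cball w \<rho>" .
  have "w \<in> D N" if "a < N" for N
  proof -
    have "w \<in> cball w \<rho>" using lim(3) by simp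
    then have "w \<in> disc_of (weyl_circle a p q c h d lam \<alpha> N)" using that unfolding int[symmetric] by blast
    then show ?thesis unfolding disc[OF that] .
  qed
  then have "weyl_comb w \<in> l2 a" unfolding l2_iff_energy_bounded D_def by blast
  moreover have "0 < \<rho> \<longleftrightarrow> \<psi> \<in> l2 a"
  proof
    assume "0 < \<rho>"
    have "energy a \<psi> N \<le> 1 / (2 * \<bar>Im lam\<bar> * \<rho>)" if "a < N" for N
    proof -
      have "\<rho> \<le> radius N" using lim(2)[of "nat (N - a - 1)"] that by simp
      then show ?thesis
        using \<open>0 < \<rho>\<close> energy_psi_pos[OF that] nonreal by (simp add: radius_def field_simps)
    qed
    then show "\<psi> \<in> l2 a" unfolding l2_iff_energy_bounded by blast
  next
    assume "\<psi> \<in> l2 a"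
    then obtain B where B: "\<And>N. a < N \<Longrightarrow> energy a \<psi> N \<le> B"
      unfolding l2_iff_energy_bounded by blast
    have B0: "0 < B" using B[of "a + 1"] energy_psi_pos[of "a + 1"] by simp
    have "1 / (2 * (\<bar>Im lam\<bar> * B)) \<le> radius (?N n)" for n
      unfolding radius_def using B[of "?N n"] energy_psi_pos[of "?N n"] nonreal
      by (intro divide_left_mono mult_left_mono mult_pos_pos) auto
    then have "1 / (2 * (\<bar>Im lam\<bar> * B)) \<le> \<rho>" using LIMSEQ_le_const[OF lim(1)] by blast
    moreover have "0 < 1 / (2 * (\<bar>Im lam\<bar> * B))" using B0 nonreal by simp
    ultimately show "0 < \<rho>" by linarith
  qed
  ultimately show ?thesis using that lim(3) int by blast
qed

lemma circle_if_psi_l2: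
  assumes "\<psi> \<in> l2 a"
  shows "converges_to_circle a (weyl_circle a p q c h d lam \<alpha>)"
proof (rule weyl_discs_limit)
  fix w \<rho> assume "0 < \<rho> \<longleftrightarrow> \<psi> \<in> l2 a"
    and "(\<Inter>N\<in>{a<..}. disc_of (weyl_circle a p q c h d lam \<alpha> N)) = cball w \<rho>"
  then show ?thesis
    unfolding converges_to_circle_def using assms by (intro exI[of _ w] exI[of _ \<rho>] conjI) simp
qed

lemma point_or_two_l2_solutions:
  "converges_to_point a (weyl_circle a p q c h d lam \<alpha>) \<or> two_l2_solutions a p q c h d lam"
proof -
  obtain w \<rho> where *: "0 \<le> \<rho>" "0 < \<rho> \<longleftrightarrow> \<psi> \<in> l2 a" "weyl_comb w \<in> l2 a"
    "(\<Inter>N\<in>{a<..}. disc_of (weyl_circle a p q c h d lam \<alpha> N)) = cball w \<rho>"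
    using weyl_discs_limit .
  show ?thesis
  proof (cases "\<psi> \<in> l2 a")
    case True
    have "bracket (weyl_comb w) \<psi> (a - 1) = bracket \<phi> \<psi> (a - 1)"
      unfolding bracket_def weyl_comb_1 qd_weyl_comb by (simp add: algebra_simps)
    then have "lin_indep a (weyl_comb w) \<psi>"
      using lin_indep_if_bracket bracket_phi_psi[of "a - 1"] by simp
    then show ?thesis
      unfolding two_l2_solutions_def using True *(3) sol_weyl_comb sol_psi by blast
  next
    case False
    then have "\<rho> = 0" using * by simp
    then show ?thesis unfolding converges_to_point_def using *(4) by auto
  qed
qed

end

section \<open>The limit circle and limit point alternative\<close>

text \<open>The values of \<open>f\<close> belong to \<open>sigma_range a f\<close>, since there the infimum is attained.\<close>

lemma Omega'_not_value:
  assumes "lam \<in> Omega' a f g" "a - 1 \<le> t"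
  shows "lam \<noteq> of_real (f t)"
proof
  assume "lam = of_real (f t)"
  have "(INF s\<in>{a - 1..}. \<bar>f t - f s\<bar>) = 0"
  proof (rule antisym)
    show "(INF s\<in>{a - 1..}. \<bar>f t - f s\<bar>) \<le> 0"
      using assms(2) by (intro cINF_lower2[of _ _ t] bdd_belowI[of _ 0]) auto
    show "0 \<le> (INF s\<in>{a - 1..}. \<bar>f t - f s\<bar>)" by (intro cINF_greatest) auto
  qed
  then have "f t \<in> sigma_range a f" by (simp add: sigma_range_def)
  then show False using assms(1) \<open>lam = of_real (f t)\<close> by (auto simp: Omega'_def)
qed

theorem theorem3p2:
  fixes a :: int and p q c h d :: "int \<Rightarrow> real"
  assumes "\<forall>t\<in>{a - 1..}. p t \<noteq> 0"
  shows "((\<exists>lam0\<in>Omega' a (M_fun p c h d) d. two_l2_solutions a p q c h d lam0)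
            \<longrightarrow> LCC a p q c h d) \<and>
         ((\<not> (\<exists>lam0\<in>Omega' a (M_fun p c h d) d. two_l2_solutions a p q c h d lam0))
            \<longrightarrow> LPC a p q c h d)"
proof -
  interpret weyl_system a p q c h d using assms by unfold_locales auto
  have pair: "weyl_pair a p lam" if "lam \<in> - \<real>" for lam
    using that by unfold_locales (auto simp: complex_is_Real_iff)
  show ?thesis
  proof (intro conjI impI)
    assume "\<exists>lam0\<in>Omega' a M d. two_l2_solutions a p q c h d lam0"
    then obtain lam0 \<theta> \<eta> where lam0: "lam0 \<in> Omega' a M d"
      and l2: "sol lam0 \<theta>" "sol lam0 \<eta>" "\<theta> \<in> l2 a" "\<eta> \<in> l2 a" "lin_indep a \<theta> \<eta>"
      unfolding two_l2_solutions_def by blast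
    show "LCC a p q c h d"
      unfolding LCC_def
    proof (intro ballI)
      fix lam :: complex and \<alpha> :: real assume "lam \<in> - \<real>"
      then interpret weyl_pair a p q c h d lam \<alpha> by (rule pair)
      show "converges_to_circle a (weyl_circle a p q c h d lam \<alpha>)"
        by (intro circle_if_psi_l2 l2_transfer[OF l2 Omega'_not_value[OF lam0] nonreal sol_psi])
    qed
  next
    assume none: "\<not> (\<exists>lam0\<in>Omega' a M d. two_l2_solutions a p q c h d lam0)"
    show "LPC a p q c h d"
      unfolding LPC_def
    proof (intro ballI)
      fix lam :: complex and \<alpha> :: real assume lam: "lam \<in> - \<real>"
      then interpret weyl_pair a p q c h d lam \<alpha> by (rule pair)
      have "lam \<in> Omega' a M d" using lam unfolding Omega'_def by auto
      then show "converges_to_point a (weyl_circle a p q c h d lam \<alpha>)"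
        using none point_or_two_l2_solutions by blast
    qed
  qed
qed

end
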